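(* Let $A\in\mathbb{R}^{n\times n}$, $B\in\mathbb{R}^{n\times m}$, $C\in\mathbb{R}^{p\times n}$, $D\in\mathbb{R}^{p\times m}$, and let $Q=C^{T}C$, $S=C^{T}D$, $R=D^{T}D$. Let $X=X^{T}$ and $Y=Y^{T}$ be two solutions of CGDARE($\Sigma$), and let $A_X$ and $A_Y$ be the corresponding closed-loop matrices. Then $\mathcal{R}^{\star}_{\ker X}=\mathcal{R}^{\star}_{\ker Y}$, and $A_X|_{\mathcal{R}^{\star}_{\ker X}}=A_Y|_{\mathcal{R}^{\star}_{\ker Y}}$ (equality of the restrictions of the linear maps $A_X$ and $A_Y$ to this common subspace).
   Context: $M^{\dagger}$ denotes the Moore-Penrose pseudo-inverse of $M$. With $\Sigma=(A,B;Q,R,S)$, $X=X^{T}\in\mathbb{R}^{n\times n}$ is a solution of CGDARE($\Sigma$) if $X=A^{T}XA-(A^{T}XB+S)(R+B^{T}XB)^{\dagger}(B^{T}XA+S^{T})+Q$ and $\ker(R+B^{T}XB)\subseteq\ker(A^{T}XB+S)$. The closed-loop matrix is $A_X=A-B(R+B^{T}XB)^{\dagger}(B^{T}XA+S^{T})$. The matrices $C,D$ come from a factorisation of the positive semidefinite Popov matrix $\begin{bmatrix}Q&S\\ S^{T}&R\end{bmatrix}=\begin{bmatrix}C^{T}\\ D^{T}\end{bmatrix}\begin{bmatrix}C&D\end{bmatrix}$. A subspace $\mathcal{V}\subseteq\mathbb{R}^n$ is output-nulling for $(A,B,C,D)$ if $\begin{bmatrix}A\\ C\end{bmatrix}\mathcal{V}\subseteq(\mathcal{V}\oplus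 0_p)+\operatorname{im}\begin{bmatrix}B\\ D\end{bmatrix}$, where $0_p$ is the zero subspace of $\mathbb{R}^p$ (for a solution $X$ as in the claim, $\ker X$ is output-nulling). The reachable subspace $\mathcal{R}^{\star}_{\mathcal{V}}$ on an output-nulling subspace $\mathcal{V}$ is the set of points of $\mathcal{V}$ that can be reached from the origin along trajectories contained in $\mathcal{V}$ while maintaining the output at zero: $x\in\mathcal{R}^{\star}_{\mathcal{V}}$ iff there are $N\ge0$ and inputs $u_0,\dots,u_{N-1}$ such that the trajectory $x_{t+1}=Ax_t+Bu_t$ with $x_0=0$ satisfies $x_t\in\mathcal{V}$ for $0\le t\le N$, $Cx_t+Du_t=0$ for $0\le t<N$, and $x_N=x$. *)

theory Defs
  imports "HOL-Analysis.Analysis"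
begin

section \<open>Moore-Penrose pseudo-inverse\<close>

definition is_pinv :: "real^'n^'m \<Rightarrow> real^'m^'n \<Rightarrow> bool" where
  "is_pinv M P \<longleftrightarrow>
     M ** P ** M = M \<and>
     P ** M ** P = P \<and>
     transpose (M ** P) = M ** P \<and>
     transpose (P ** M) = P ** M"

text \<open>Existence and uniqueness, which justify the definite description, are proved below.\<close>

definition pinv :: "real^'n^'m \<Rightarrow> real^'m^'n" where
  "pinv M = (THE P. is_pinv M P)"

lemma is_pinv_unique:
  assumes "is_pinv M P" and "is_pinv M P'"
  shows "P = P'"
proof -
  have MP: "M ** P = M ** P'"
  proof -
    have "M ** P = transpose (M ** P' ** (M ** P))"
      using assms by (simp add: is_pinv_def matrix_mul_assoc)
    also have "\<dots> = transpose (M ** P) ** transpose (M ** P')"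
      by (rule matrix_transpose_mul)
    also have "\<dots> = M ** P'"
      using assms by (simp add: is_pinv_def matrix_mul_assoc)
    finally show ?thesis .
  qed
  have PM: "P ** M = P' ** M"
  proof -
    have "P ** M = transpose (P ** M ** (P' ** M))"
      using assms by (metis is_pinv_def matrix_mul_assoc)
    also have "\<dots> = transpose (P' ** M) ** transpose (P ** M)"
      by (rule matrix_transpose_mul)
    also have "\<dots> = P' ** M"
      using assms by (metis is_pinv_def matrix_mul_assoc)
    finally show ?thesis .
  qed
  have "P = P ** M ** P" using assms by (simp add: is_pinv_def)
  also have "\<dots> = P' ** M ** P'" using MP PM by (metis matrix_mul_assoc)
  also have "\<dots> = P'" using assms by (simp add: is_pinv_def)
  finally show ?thesis .
qed

lemma transpose_eq_selfI:
  fixes K :: "real^'n^'n"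
  assumes "\<And>x y. (K *v x) \<bullet> y = x \<bullet> (K *v y)"
  shows "transpose K = K"
proof -
  have "transpose K *v x = K *v x" for x
  proof -
    have "(transpose K *v x) \<bullet> y = (K *v x) \<bullet> y" for y
      using assms by (simp add: dot_lmul_matrix)
    then show ?thesis using vector_eq_rdot by blast
  qed
  then show ?thesis by (simp add: matrix_eq)
qed

lemma is_pinv_exists:
  fixes M :: "real^'n^'m"
  shows "\<exists>P. is_pinv M P"
proof -
  \<comment> \<open>\<open>best y x\<close>: \<open>x\<close> is the minimum-norm least-squares solution of \<open>M x = y\<close>.\<close>
  define best where "best y x \<longleftrightarrow>
    (\<forall>k. M *v k = 0 \<longrightarrow> x \<bullet> k = 0) \<and> (\<forall>z. (y - M *v x) \<bullet> (M *v z) = 0)" for y x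
  have ex: "\<exists>x. best y x" for y
  proof -
    obtain a b where a: "a \<in> span (range ((*v) M))"
      and b: "\<And>w. w \<in> span (range ((*v) M)) \<Longrightarrow> orthogonal b w" and y: "y = a + b"
      using orthogonal_subspace_decomp_exists by metis
    have "subspace (range ((*v) M))"
      by (intro linear_subspace_image matrix_vector_mul_linear subspace_UNIV)
    then obtain x0 where x0: "a = M *v x0" using a by (auto simp: span_eq_iff[THEN iffD2])
    obtain k c where k: "k \<in> span {k. M *v k = 0}"
      and c: "\<And>w. w \<in> span {k. M *v k = 0} \<Longrightarrow> orthogonal c w" and xkc: "x0 = k + c"
      using orthogonal_subspace_decomp_exists by metis
    have "subspace {k. M *v k = 0}"
      by (auto simp: subspace_def matrix_vector_right_distrib matrix_vector_mult_scaleR)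
    then have "M *v k = 0" using k by (metis (mono_tags) mem_Collect_eq span_eq_iff)
    then have "M *v c = a" by (simp add: x0 xkc matrix_vector_right_distrib)
    then have "best y c"
      unfolding best_def using b c
      by (auto simp: y orthogonal_def span_base)
    then show ?thesis ..
  qed
  have uniq: "x = x'" if "best y x" "best y x'" for y x x'
  proof -
    have "(M *v (x - x')) \<bullet> (M *v (x - x')) = 
        (y - M *v x') \<bullet> (M *v (x - x')) - (y - M *v x) \<bullet> (M *v (x - x'))"
      by (simp add: matrix_vector_mult_diff_distrib inner_diff_left)
    then have "M *v (x - x') = 0" using that by (simp add: best_def)
    then have "(x - x') \<bullet> (x - x') = 0"
      using that by (simp add: best_def inner_diff_left)
    then show ?thesis by simp
  qed
  obtain f where f: "\<And>y. best y (f y)" using ex by metis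
  have lin: "linear f"
  proof (rule linearI)
    fix a b
    have "best (a + b) (f a + f b)"
      using f[of a] f[of b]
      by (simp add: best_def inner_left_distrib matrix_vector_right_distrib inner_diff_left)
    then show "f (a + b) = f a + f b" using uniq f by blast
  next
    fix r a
    have "best (r *\<^sub>R a) (r *\<^sub>R f a)"
      using f[of a]
      by (simp add: best_def matrix_vector_mult_scaleR inner_diff_left)
    then show "f (r *\<^sub>R a) = r *\<^sub>R f a" using uniq f by blast
  qed
  define P where "P = matrix f"
  have P: "best y (P *v y)" for y
    using f lin by (simp add: P_def matrix_works)
  have MPM: "M *v (P *v (M *v x)) = M *v x" for x
  proof -
    have "(M *v x - M *v (P *v (M *v x))) \<bullet> (M *v (x - P *v (M *v x))) = 0"
      using P[of "M *v x"] by (simp only: best_def)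
    then show ?thesis by (simp add: matrix_vector_mult_diff_distrib)
  qed
  have PMP: "P *v (M *v (P *v y)) = P *v y" for y
  proof -
    have "best (M *v (P *v y)) (P *v y)" using P[of y] by (simp add: best_def)
    then show ?thesis using uniq P by blast
  qed
  have MPsym: "(M *v (P *v y)) \<bullet> z = y \<bullet> (M *v (P *v z))" for y z
  proof -
    have "(y - M *v (P *v y)) \<bullet> (M *v (P *v z)) = 0"
      "(z - M *v (P *v z)) \<bullet> (M *v (P *v y)) = 0"
      using P by (auto simp: best_def)
    then show ?thesis
      unfolding inner_diff_left by (metis eq_iff_diff_eq_0 inner_commute)
  qed
  have PMsym: "(P *v (M *v x)) \<bullet> z = x \<bullet> (P *v (M *v z))" for x z
  proof -
    have "(P *v (M *v x)) \<bullet> (z - P *v (M *v z)) = 0"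
      "(P *v (M *v z)) \<bullet> (x - P *v (M *v x)) = 0"
      using P MPM by (auto simp: best_def matrix_vector_mult_diff_distrib)
    then show ?thesis
      unfolding inner_diff_right by (metis eq_iff_diff_eq_0 inner_commute)
  qed
  have "is_pinv M P"
    unfolding is_pinv_def
    by (intro conjI transpose_eq_selfI)
      (auto simp: matrix_eq MPM PMP MPsym PMsym simp flip: matrix_vector_mul_assoc)
  then show ?thesis ..
qed

lemma is_pinv_pinv: "is_pinv M (pinv M)"
  unfolding pinv_def using is_pinv_exists is_pinv_unique by (metis theI)

section \<open>Constrained generalised discrete algebraic Riccati equation\<close>

definition mat_ker :: "real^'n^'m \<Rightarrow> (real^'n) set" where
  "mat_ker M = {x. M *v x = 0}"

definition cgdare_solution ::
  "real^'n^'n \<Rightarrow> real^'m^'n \<Rightarrow> real^'n^'n \<Rightarrow> real^'m^'m \<Rightarrow> real^'m^'n \<Rightarrow> real^'n^'n \<Rightarrow> bool"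
where
  "cgdare_solution A B Q R S X \<longleftrightarrow>
     transpose X = X \<and>
     X = transpose A ** X ** A
         - (transpose A ** X ** B + S) ** pinv (R + transpose B ** X ** B)
             ** (transpose B ** X ** A + transpose S)
         + Q \<and>
     mat_ker (R + transpose B ** X ** B) \<subseteq> mat_ker (transpose A ** X ** B + S)"

definition closed_loop ::
  "real^'n^'n \<Rightarrow> real^'m^'n \<Rightarrow> real^'m^'m \<Rightarrow> real^'m^'n \<Rightarrow> real^'n^'n \<Rightarrow> real^'n^'n"
where
  "closed_loop A B R S X =
     A - B ** pinv (R + transpose B ** X ** B) ** (transpose B ** X ** A + transpose S)"

section \<open>Reachable subspace\<close>

primrec trajectory ::
  "real^'n^'n \<Rightarrow> real^'m^'n \<Rightarrow> (nat \<Rightarrow> real^'m) \<Rightarrow> nat \<Rightarrow> real^'n"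
where
  "trajectory A B u 0 = 0"
| "trajectory A B u (Suc t) = A *v trajectory A B u t + B *v u t"

text \<open>
  Inputs are infinite sequences, of which only the first \<open>N\<close> values matter.  The set is defined
  for an arbitrary \<open>V\<close>; the notion is used for output-nulling subspaces \<open>V\<close>, such as the kernel
  of a solution of the Riccati equation.
\<close>

definition reachable_on ::
  "real^'n^'n \<Rightarrow> real^'m^'n \<Rightarrow> real^'n^'p \<Rightarrow> real^'m^'p \<Rightarrow> (real^'n) set \<Rightarrow> (real^'n) set"
where
  "reachable_on A B C D V =
     {x. \<exists>N u. (\<forall>t\<le>N. trajectory A B u t \<in> V) \<and>
               (\<forall>t<N. C *v trajectory A B u t + D *v u t = 0) \<and>
               trajectory A B u N = x}"

end

theory Submission
  imports Defs
begin

text \<open>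
  Along a solution \<open>X\<close> the Riccati equation completes the square in the cost, with a gain \<open>K\<close> and
  the weight \<open>W = R + B\<^sup>T X B\<close>.  A trajectory in \<open>ker X\<close> with zero output is therefore generated by
  the closed loop with inputs in \<open>ker W\<close>.  Since the reachable subspaces of a linear system
  stabilise, such a trajectory can be continued, still with inputs in \<open>ker W\<close>, until it returns
  to the origin.  The energy balance shows that a trajectory from \<open>0\<close> to \<open>0\<close> with these inputs has
  zero output, although \<open>X\<close> need not be semidefinite.  Running the completed square of \<open>Y\<close>
  backwards from the final state \<open>0\<close> then puts the whole trajectory in \<open>ker Y\<close> and shows that
  \<open>ker W\<close> is the same for \<open>X\<close> and \<open>Y\<close>; the gains agree on the trajectory because their values are
  orthogonal to \<open>ker W\<close>.
\<close>

section \<open>Trajectories\<close>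

lemma trajectory_cong:
  assumes "\<And>s. s < t \<Longrightarrow> u s = v s"
  shows "trajectory A B u t = trajectory A B v t"
  using assms by (induction t) auto

lemma trajectory_add:
  "trajectory A B (\<lambda>t. u t + v t) t = trajectory A B u t + trajectory A B v t"
  by (induction t) (auto simp: matrix_vector_right_distrib)

lemma trajectory_scaleR:
  "trajectory A B (\<lambda>t. c *\<^sub>R u t) t = c *\<^sub>R trajectory A B u t"
  by (induction t) (auto simp: matrix_vector_mult_scaleR algebra_simps)

lemma trajectory_zero: "trajectory A B (\<lambda>t. 0) t = 0"
  by (induction t) auto

text \<open>Zero inputs keep the state at the origin, so every trajectory can be started
  later.\<close>

lemma trajectory_delay:
  "trajectory A B (\<lambda>t. if t < k then 0 else u (t - k)) (k + t) = trajectory A B u t"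
proof (induction t)
  case 0
  have "trajectory A B (\<lambda>t. if t < k then 0 else u (t - k)) k = trajectory A B (\<lambda>t. 0) k"
    by (rule trajectory_cong) auto
  then show ?case by (simp add: trajectory_zero)
qed auto

text \<open>The feedback term added to the input cancels the one subtracted from \<open>A\<close>;
  the states do not change.\<close>

lemma trajectory_feedback:
  assumes "\<And>t. v t = u t + K *v trajectory A B u t"
  shows "trajectory (A - B ** K) B v t = trajectory A B u t"
  by (induction t)
    (auto simp: assms matrix_vector_mult_diff_rdistrib matrix_vector_right_distrib
      simp flip: matrix_vector_mul_assoc)

text \<open>The points reachable in \<open>k\<close> steps form subspaces that grow with
  \<open>k\<close>, by delaying inputs. Their dimensions are bounded, so one of maximal dimension
  contains all the others.\<close>

lemma reachable_subspaces_stabilise: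
  fixes A :: "real^'n^'n" and B :: "real^'m^'n"
  assumes U: "subspace U"
  shows "\<exists>n. \<forall>k v. (\<forall>t. v t \<in> U) \<longrightarrow>
    (\<exists>w. (\<forall>t. w t \<in> U) \<and> trajectory A B w n = trajectory A B v k)"
proof -
  define Re where "Re k = {trajectory A B v k | v. \<forall>t. v t \<in> U}" for k
  have sub: "subspace (Re k)" for k
    unfolding subspace_def
  proof (intro conjI ballI allI)
    show "0 \<in> Re k"
      unfolding Re_def using subspace_0[OF U] trajectory_zero[of A B k] by fastforce
    show "x + y \<in> Re k" if xy: "x \<in> Re k" "y \<in> Re k" for x y
    proof -
      obtain v w where "x = trajectory A B v k" "y = trajectory A B w k"
        "\<forall>t. v t \<in> U" "\<forall>t. w t \<in> U"
        using xy by (auto simp: Re_def)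
      then show ?thesis
        unfolding Re_def using subspace_add[OF U]
        by (auto intro!: exI[of _ "\<lambda>t. v t + w t"] simp: trajectory_add)
    qed
    show "c *\<^sub>R x \<in> Re k" if x: "x \<in> Re k" for c x
    proof -
      obtain v where "x = trajectory A B v k" "\<forall>t. v t \<in> U"
        using x by (auto simp: Re_def)
      then show ?thesis
        unfolding Re_def using subspace_scale[OF U]
        by (auto intro!: exI[of _ "\<lambda>t. c *\<^sub>R v t"] simp: trajectory_scaleR)
    qed
  qed
  have mono: "Re k \<subseteq> Re (j + k)" for j k
  proof
    fix x assume "x \<in> Re k"
    then obtain v where "x = trajectory A B v k" "\<forall>t. v t \<in> U" by (auto simp: Re_def)
    then show "x \<in> Re (j + k)"
      unfolding Re_def using subspace_0[OF U]
      by (auto intro!: exI[of _ "\<lambda>t. if t < j then 0 else v (t - j)"] simp: trajectory_delay)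
  qed
  have "\<forall>k. dim (Re k) < Suc CARD('n)"
    by (simp add: dim_subset_UNIV_cart le_imp_less_Suc)
  then obtain n where n: "\<And>k. dim (Re k) \<le> dim (Re n)"
    using ex_has_greatest_nat[of "\<lambda>_. True" 0 "\<lambda>k. dim (Re k)" "Suc CARD('n)"] by auto
  have stab: "Re k \<subseteq> Re n" for k
  proof -
    have "Re n = Re (k + n)"
      by (rule subspace_dim_equal[OF sub sub mono n])
    moreover have "Re k \<subseteq> Re (k + n)"
      using mono[of k n] by (simp add: add.commute)
    ultimately show ?thesis by simp
  qed
  have "\<exists>w. (\<forall>t. w t \<in> U) \<and> trajectory A B w n = trajectory A B v k"
    if "\<forall>t. v t \<in> U" for k v
  proof -
    have "trajectory A B v k \<in> Re n" using that stab[of k] by (auto simp: Re_def)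
    then show ?thesis by (auto simp: Re_def)
  qed
  then show ?thesis by blast
qed

lemma trajectory_extends_to_zero:
  assumes U: "subspace U" and v: "\<And>t. t < N \<Longrightarrow> v t \<in> U"
  shows "\<exists>w M. N \<le> M \<and> (\<forall>t. w t \<in> U) \<and> (\<forall>t<N. w t = v t) \<and> trajectory A B w M = 0"
proof -
  obtain n where n: "\<forall>k v. (\<forall>t. v t \<in> U) \<longrightarrow>
      (\<exists>w. (\<forall>t. w t \<in> U) \<and> trajectory A B w n = trajectory A B v k)"
    using reachable_subspaces_stabilise[OF U, of A B] by (elim exE)
  define v0 where "v0 t = (if t < N then v t else 0)" for t
  have v0: "v0 t \<in> U" for t using v subspace_0[OF U] by (auto simp: v0_def)
  then obtain r where r: "\<And>t. r t \<in> U" "trajectory A B r n = trajectory A B v0 (N + n)"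
    using n by blast
  \<comment> \<open>After time \<open>N\<close> the input \<open>v0\<close> is zero, and
    \<open>r\<close> reaches in \<open>n\<close> steps the state that \<open>v0\<close> has at
    \<open>N + n\<close>. Subtracting \<open>r\<close> delayed by \<open>N\<close> cancels this
    state without touching the first \<open>N\<close> inputs.\<close>
  define w where "w t = v0 t + (- 1) *\<^sub>R (if t < N then 0 else r (t - N))" for t
  have "trajectory A B w (N + n) = 0"
    unfolding w_def trajectory_add trajectory_scaleR trajectory_delay r(2) by simp
  moreover have "w t \<in> U" for t
    unfolding w_def using v0 r(1) U by (intro subspace_add subspace_scale) (auto intro: subspace_0)
  moreover have "w t = v t" if "t < N" for t using that by (simp add: w_def v0_def)
  ultimately show ?thesis by (intro exI[of _ w] exI[of _ "N + n"]) simp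
qed

section \<open>Completing the square\<close>

lemma pinv_symmetric:
  assumes "transpose M = M"
  shows "transpose (pinv M) = pinv M"
proof (rule is_pinv_unique[of M])
  have "is_pinv M (pinv M)" by (rule is_pinv_pinv)
  then show "is_pinv M (transpose (pinv M))"
    unfolding is_pinv_def using assms
    by (metis matrix_mul_assoc matrix_transpose_mul transpose_transpose)
qed (rule is_pinv_pinv)

lemma transpose_add: "transpose (M + N) = transpose M + transpose N"
  by (simp add: transpose_def vec_eq_iff)

lemma inner_transpose: "x \<bullet> (transpose M *v y) = (M *v x) \<bullet> y"
  for M :: "real^'n^'m"
  by (metis dot_lmul_matrix transpose_matrix_vector inner_commute)

lemma symmetric_inner:
  fixes M :: "real^'n^'n"
  assumes "transpose M = M"
  shows "(M *v x) \<bullet> y = x \<bullet> (M *v y)"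
  using inner_transpose[of x M y] assms by simp

locale riccati_solution =
  fixes A :: "real^'n^'n" and B :: "real^'m^'n" and C :: "real^'n^'p" and D :: "real^'m^'p"
    and X :: "real^'n^'n"
  assumes solution: "cgdare_solution A B (transpose C ** C) (transpose D ** D) (transpose C ** D) X"
begin

definition weight :: "real^'m^'m" where
  "weight = transpose D ** D + transpose B ** X ** B"

definition cross :: "real^'m^'n" where
  "cross = transpose A ** X ** B + transpose C ** D"

text \<open>The sign is that of the feedback \<open>u = - (gain *v x)\<close>, so
  \<open>u + gain *v x\<close> measures the deviation from it.\<close>

definition gain :: "real^'n^'m" where
  "gain = pinv weight ** transpose cross"

lemma X_symmetric: "transpose X = X"
  using solution by (simp add: cgdare_solution_def)

lemma transpose_cross: "transpose cross = transpose B ** X ** A + transpose (transpose C ** D)"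
  by (simp add: cross_def transpose_add matrix_transpose_mul X_symmetric matrix_mul_assoc)

lemma weight_symmetric: "transpose weight = weight"
  by (simp add: weight_def transpose_add matrix_transpose_mul X_symmetric matrix_mul_assoc)

lemma closed_loop_eq:
  "closed_loop A B (transpose D ** D) (transpose C ** D) X = A - B ** gain"
  by (simp add: closed_loop_def gain_def transpose_cross weight_def matrix_mul_assoc)

lemma equation: "X = transpose A ** X ** A - cross ** gain + transpose C ** C"
proof -
  have "X = transpose A ** X ** A - cross ** pinv weight ** transpose cross + transpose C ** C"
    using solution unfolding cgdare_solution_def transpose_cross by (simp add: weight_def cross_def)
  then show ?thesis by (simp add: gain_def matrix_mul_assoc)
qed

text \<open>This is the kernel condition at work: \<open>pinv weight ** weight\<close> moves a
  vector only by an element of the kernel of \<open>weight\<close>, on which \<open>cross\<close>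
  vanishes.\<close>

lemma cross_pinv_weight: "cross ** pinv weight ** weight = cross"
proof -
  have ker: "cross *v y = 0" if "weight *v y = 0" for y
    using solution that by (auto simp: cgdare_solution_def mat_ker_def weight_def cross_def)
  have "weight ** pinv weight ** weight = weight"
    using is_pinv_pinv[of weight] by (simp add: is_pinv_def)
  then have "weight *v (pinv weight *v (weight *v y) - y) = 0" for y
    by (simp add: matrix_vector_mult_diff_distrib matrix_vector_mul_assoc matrix_mul_assoc)
  then have "cross *v (pinv weight *v (weight *v y) - y) = 0" for y using ker by blast
  then show ?thesis
    by (simp add: matrix_eq matrix_vector_mult_diff_distrib matrix_vector_mul_assoc matrix_mul_assoc)
qed

lemma weight_gain: "weight ** gain = transpose cross"
proof -
  have "transpose cross = transpose (cross ** pinv weight ** weight)"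
    by (simp add: cross_pinv_weight)
  also have "\<dots> = weight ** gain"
    by (simp add: matrix_transpose_mul weight_symmetric pinv_symmetric gain_def matrix_mul_assoc)
  finally show ?thesis ..
qed

text \<open>The symmetric projection \<open>pinv weight ** weight\<close> fixes the values of
  \<open>gain\<close> and kills the kernel of \<open>weight\<close>.\<close>

lemma gain_orthogonal:
  assumes "weight *v y = 0"
  shows "y \<bullet> (gain *v x) = 0"
proof -
  have P: "transpose (pinv weight ** weight) = pinv weight ** weight"
    "pinv weight ** weight ** pinv weight = pinv weight"
    using is_pinv_pinv[of weight] by (auto simp: is_pinv_def)
  have "y \<bullet> (gain *v x) = y \<bullet> ((pinv weight ** weight) *v (gain *v x))"
    by (simp add: gain_def matrix_vector_mul_assoc matrix_mul_assoc P)
  also have "\<dots> = (pinv weight *v (weight *v y)) \<bullet> (gain *v x)"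
    by (metis P(1) symmetric_inner matrix_vector_mul_assoc)
  finally show ?thesis by (simp add: assms)
qed

text \<open>The identity is polarised because \<open>X\<close> and \<open>weight\<close> may be
  indefinite: vanishing of the quadratic form at one point would say too little.\<close>

lemma completed_square:
  "(C *v x + D *v u) \<bullet> (C *v z + D *v w) + (A *v x + B *v u) \<bullet> (X *v (A *v z + B *v w))
    = x \<bullet> (X *v z) + (u + gain *v x) \<bullet> (weight *v (w + gain *v z))"
proof -
  have W: "a \<bullet> (weight *v b) = (D *v a) \<bullet> (D *v b) + (B *v a) \<bullet> (X *v (B *v b))" for a b
    by (simp add: weight_def matrix_vector_mult_add_rdistrib inner_add_right inner_transpose
        del: transpose_matrix_vector flip: matrix_vector_mul_assoc)
  have G: "a \<bullet> (cross *v b) = (C *v a) \<bullet> (D *v b) + (A *v a) \<bullet> (X *v (B *v b))" for a b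
    by (simp add: cross_def matrix_vector_mult_add_rdistrib inner_add_right inner_transpose
        del: transpose_matrix_vector flip: matrix_vector_mul_assoc)
  have E: "x \<bullet> (X *v z) = (A *v x) \<bullet> (X *v (A *v z)) - x \<bullet> (cross *v (gain *v z))
      + (C *v x) \<bullet> (C *v z)" for x z
    by (subst equation)
      (simp add: matrix_vector_mult_add_rdistrib matrix_vector_mult_diff_rdistrib inner_add_right
        inner_diff_right inner_transpose
        del: transpose_matrix_vector flip: matrix_vector_mul_assoc)
  have WK: "a \<bullet> (weight *v (gain *v b)) = b \<bullet> (cross *v a)" for a b
    using inner_transpose[of a cross b]
    by (simp add: matrix_vector_mul_assoc weight_gain inner_commute del: transpose_matrix_vector)
  have KW: "(gain *v b) \<bullet> (weight *v a) = b \<bullet> (cross *v a)" for a b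
    using WK[of a b] symmetric_inner[OF weight_symmetric, of a "gain *v b"]
    by (simp add: inner_commute)
  have XS: "(B *v u) \<bullet> (X *v (A *v z)) = (A *v z) \<bullet> (X *v (B *v u))"
    using symmetric_inner[OF X_symmetric, of "B *v u"] by (simp add: inner_commute)
  have "(u + gain *v x) \<bullet> (weight *v (w + gain *v z))
      = u \<bullet> (weight *v w) + z \<bullet> (cross *v u) + x \<bullet> (cross *v w) + x \<bullet> (cross *v (gain *v z))"
    by (simp add: matrix_vector_right_distrib inner_add_left inner_add_right WK[of u] KW)
  then show ?thesis
    unfolding E[of x z] W[of u w] G[of z u] G[of x w] matrix_vector_right_distrib
      inner_add_left inner_add_right XS
    by (simp add: inner_commute)
qed

section \<open>Trajectories with zero output\<close>

text \<open>The left side of \<open>completed_square\<close> vanishes for every second pair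
  \<open>z\<close>, \<open>w\<close>, which can then be chosen to isolate either term on the
  right.\<close>

lemma zero_output_backwards:
  assumes "C *v x + D *v u = 0" and "X *v (A *v x + B *v u) = 0"
  shows "X *v x = 0" and "weight *v (u + gain *v x) = 0"
proof -
  have *: "x \<bullet> (X *v z) + (u + gain *v x) \<bullet> (weight *v (w + gain *v z)) = 0" for z w
    using completed_square[of x u z w] assms
    by (simp flip: symmetric_inner[OF X_symmetric])
  \<comment> \<open>This choice of \<open>w\<close> makes the deviation of the second pair
    zero.\<close>
  have "x \<bullet> (X *v z) = 0" for z using *[of z "- (gain *v z)"] by simp
  then show "X *v x = 0"
    by (metis inner_eq_zero_iff symmetric_inner[OF X_symmetric])
  have "(u + gain *v x) \<bullet> (weight *v w) = 0" for w using *[of 0 w] by simp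
  then show "weight *v (u + gain *v x) = 0"
    by (metis inner_eq_zero_iff symmetric_inner[OF weight_symmetric])
qed

lemma zero_output_trajectory:
  assumes "\<And>t. t < N \<Longrightarrow> C *v trajectory A B u t + D *v u t = 0"
    and "X *v trajectory A B u N = 0"
  shows "t \<le> N \<Longrightarrow> X *v trajectory A B u t = 0"
    and "t < N \<Longrightarrow> weight *v (u t + gain *v trajectory A B u t) = 0"
proof -
  have X0: "X *v trajectory A B u t = 0" if "t \<le> N" for t
    using that
  proof (induction t rule: inc_induct)
    case (step t)
    then show ?case
      using zero_output_backwards(1)[OF assms(1)[OF \<open>t < N\<close>]] by simp
  qed (rule assms(2))
  then show "t \<le> N \<Longrightarrow> X *v trajectory A B u t = 0" .
  show "t < N \<Longrightarrow> weight *v (u t + gain *v trajectory A B u t) = 0"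
    using zero_output_backwards(2) assms(1) X0[of "Suc t"] by simp
qed

text \<open>The energy balance telescopes to the difference of the end values of the form of
  \<open>X\<close>, both zero. A vanishing sum of squared output norms has vanishing terms, whatever
  the sign of \<open>X\<close>.\<close>

lemma zero_output_if_returns_to_zero:
  assumes "\<And>t. weight *v (u t + gain *v trajectory A B u t) = 0"
    and "trajectory A B u M = 0" and "t < M"
  shows "C *v trajectory A B u t + D *v u t = 0"
proof -
  let ?x = "trajectory A B u"
  define y where "y t = C *v ?x t + D *v u t" for t
  have "y t \<bullet> y t + ?x (Suc t) \<bullet> (X *v ?x (Suc t)) = ?x t \<bullet> (X *v ?x t)" for t
    using completed_square[of "?x t" "u t" "?x t" "u t"] by (simp add: y_def assms(1))
  then have "(\<Sum>s<k. y s \<bullet> y s) = - (?x k \<bullet> (X *v ?x k))" for k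
    by (induction k) (simp, smt (verit) sum.lessThan_Suc)
  then have "(\<Sum>s<M. y s \<bullet> y s) = 0" by (simp add: assms(2))
  then have "y t \<bullet> y t = 0"
    using assms(3) by (subst (asm) sum_nonneg_eq_0_iff) auto
  then show ?thesis by (simp add: y_def)
qed

text \<open>In terms of the deviations, which are inputs of the closed loop, the constraint is
  membership in a fixed subspace, so \<open>trajectory_extends_to_zero\<close> applies.\<close>

lemma extend_to_zero_output:
  assumes "\<And>t. t < N \<Longrightarrow> weight *v (u t + gain *v trajectory A B u t) = 0"
  shows "\<exists>w M. N \<le> M \<and> (\<forall>t<N. w t = u t) \<and>
    (\<forall>t<M. C *v trajectory A B w t + D *v w t = 0) \<and> trajectory A B w M = 0"
proof -
  have sub: "subspace {y. weight *v y = 0}"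
    by (auto simp: subspace_def matrix_vector_right_distrib matrix_vector_mult_scaleR)
  have ker: "\<And>t. t < N \<Longrightarrow> u t + gain *v trajectory A B u t \<in> {y. weight *v y = 0}"
    using assms by simp
  obtain v M where v: "N \<le> M" "\<And>t. weight *v v t = 0"
    "\<And>t. t < N \<Longrightarrow> v t = u t + gain *v trajectory A B u t"
    "trajectory (A - B ** gain) B v M = 0"
    using trajectory_extends_to_zero[where v = "\<lambda>t. u t + gain *v trajectory A B u t",
        OF sub ker, of N "A - B ** gain" B] by auto
  \<comment> \<open>Back to inputs of the original system, with the states of the closed
    loop.\<close>
  define w where "w t = v t - gain *v trajectory (A - B ** gain) B v t" for t
  have "trajectory A B w t = trajectory (A - B ** gain) B v t" for t
    by (induction t)
      (auto simp: w_def matrix_vector_mult_diff_rdistrib matrix_vector_mult_diff_distrib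
        simp flip: matrix_vector_mul_assoc)
  then have w: "v t = w t + gain *v trajectory A B w t" "trajectory A B w M = 0" for t
    using v(4) by (auto simp: w_def)
  have eq: "trajectory A B w t = trajectory A B u t" if "t \<le> N" for t
  proof -
    have "trajectory A B w t = trajectory (A - B ** gain) B v t"
      by (rule trajectory_feedback[OF w(1), symmetric])
    also have "\<dots> = trajectory (A - B ** gain) B (\<lambda>t. u t + gain *v trajectory A B u t) t"
      using that by (intro trajectory_cong v(3)) simp
    also have "\<dots> = trajectory A B u t" by (rule trajectory_feedback) simp
    finally show ?thesis .
  qed
  have "w t = u t" if "t < N" for t
    using v(3)[OF that] w(1)[of t] eq[of t] that by simp
  moreover have "C *v trajectory A B w t + D *v w t = 0" if "t < M" for t
    by (rule zero_output_if_returns_to_zero[OF _ w(2) that]) (simp add: v(2) flip: w(1))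
  ultimately show ?thesis using v(1) w(2) by blast
qed

end

section \<open>Comparing two solutions\<close>

text \<open>Results are proved in one direction; interpreting the locale with \<open>X\<close> and
  \<open>Y\<close> exchanged gives the other.\<close>

locale two_riccati_solutions =
  X: riccati_solution A B C D X + Y: riccati_solution A B C D Y
  for A :: "real^'n^'n" and B :: "real^'m^'n" and C :: "real^'n^'p" and D :: "real^'m^'p"
    and X Y :: "real^'n^'n"
begin

text \<open>Take \<open>y\<close> as first input from the origin and continue back to zero with zero
  output. At time 0 the state is zero, so the deviation from the feedback of \<open>Y\<close> is
  \<open>y\<close> itself.\<close>

lemma weight_kernel_subset:
  assumes "X.weight *v y = 0"
  shows "Y.weight *v y = 0"
proof -
  have "\<And>t. t < Suc 0 \<Longrightarrow> X.weight *v (y + X.gain *v trajectory A B (\<lambda>_. y) t) = 0"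
    using assms by simp
  then obtain w M where w: "Suc 0 \<le> M" "\<And>t. t < Suc 0 \<Longrightarrow> w t = y"
    "\<And>t. t < M \<Longrightarrow> C *v trajectory A B w t + D *v w t = 0" "trajectory A B w M = 0"
    using X.extend_to_zero_output[of "Suc 0" "\<lambda>_. y"] by blast
  then have "Y.weight *v (w 0 + Y.gain *v trajectory A B w 0) = 0"
    by (intro Y.zero_output_trajectory(2)[of M]) auto
  then show ?thesis using w(2) by simp
qed

lemma trajectory_comparison:
  assumes X0: "\<And>t. t \<le> N \<Longrightarrow> X *v trajectory A B u t = 0"
    and out: "\<And>t. t < N \<Longrightarrow> C *v trajectory A B u t + D *v u t = 0"
  shows "t \<le> N \<Longrightarrow> Y *v trajectory A B u t = 0"
    and "Y.weight *v (Y.gain *v trajectory A B u N - X.gain *v trajectory A B u N) = 0"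
proof -
  \<comment> \<open>One more input is appended at time \<open>N\<close>, where \<open>u\<close> is
    unconstrained. Following the feedback of \<open>X\<close> there makes the deviation for
    \<open>Y\<close> at \<open>N\<close> the difference of the two gains.\<close>
  define v where "v t = (if t < N then u t else - (X.gain *v trajectory A B u N))" for t
  have v: "trajectory A B v t = trajectory A B u t" if "t \<le> N" for t
    by (rule trajectory_cong) (use that in \<open>auto simp: v_def\<close>)
  have "X.weight *v (v t + X.gain *v trajectory A B v t) = 0" if "t < Suc N" for t
  proof (cases "t < N")
    case True
    then show ?thesis
      using X.zero_output_trajectory(2)[of N u t] out X0 v[of t] by (simp add: v_def)
  next
    case False
    then show ?thesis using that v[of N] by (simp add: v_def less_Suc_eq)
  qed
  then obtain w M where w: "Suc N \<le> M" "\<And>t. t < Suc N \<Longrightarrow> w t = v t"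
    "\<And>t. t < M \<Longrightarrow> C *v trajectory A B w t + D *v w t = 0" "trajectory A B w M = 0"
    using X.extend_to_zero_output[of "Suc N" v] by blast
  have eq: "trajectory A B w t = trajectory A B u t" if "t \<le> N" for t
    using that v w(2) trajectory_cong[of t w v A B] by simp
  show "Y *v trajectory A B u t = 0" if "t \<le> N"
    using Y.zero_output_trajectory(1)[of M w t] w that eq by simp
  have "Y.weight *v (w N + Y.gain *v trajectory A B w N) = 0"
    using Y.zero_output_trajectory(2)[of M w N] w by simp
  then show "Y.weight *v (Y.gain *v trajectory A B u N - X.gain *v trajectory A B u N) = 0"
    using w(2)[of N] eq[of N] by (simp add: v_def)
qed

lemma reachable_subset: "reachable_on A B C D (mat_ker X) \<subseteq> reachable_on A B C D (mat_ker Y)"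
  unfolding reachable_on_def mat_ker_def using trajectory_comparison(1) by blast

end

text \<open>The difference of the gains at \<open>x\<close> lies in the kernels of both weights, and
  each gain is orthogonal to its own kernel; hence the difference is orthogonal to itself.\<close>

lemma gain_eq_on_reachable:
  assumes "riccati_solution A B C D X" and "riccati_solution A B C D Y"
    and "x \<in> reachable_on A B C D (mat_ker X)"
  shows "riccati_solution.gain A B C D X *v x = riccati_solution.gain A B C D Y *v x"
proof -
  interpret XY: two_riccati_solutions A B C D X Y
    using assms by (simp add: two_riccati_solutions_def)
  interpret YX: two_riccati_solutions A B C D Y X
    using assms by (simp add: two_riccati_solutions_def)
  let ?d = "XY.Y.gain *v x - XY.X.gain *v x"
  have Y: "XY.Y.weight *v ?d = 0"
    using assms(3) XY.trajectory_comparison(2) by (auto simp: reachable_on_def mat_ker_def)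
  then have "XY.X.weight *v ?d = 0" by (rule YX.weight_kernel_subset)
  then have "?d \<bullet> ?d = 0"
    unfolding inner_diff_right[of ?d]
    using XY.X.gain_orthogonal XY.Y.gain_orthogonal Y by simp
  then show ?thesis by simp
qed

theorem theorem4p4:
  fixes A :: "real^'n^'n" and B :: "real^'m^'n" and C :: "real^'n^'p" and D :: "real^'m^'p"
    and Q :: "real^'n^'n" and R :: "real^'m^'m" and S :: "real^'m^'n"
    and X Y :: "real^'n^'n"
  assumes "Q = transpose C ** C"
    and "S = transpose C ** D"
    and "R = transpose D ** D"
    and "cgdare_solution A B Q R S X"
    and "cgdare_solution A B Q R S Y"
  shows "reachable_on A B C D (mat_ker X) = reachable_on A B C D (mat_ker Y) \<and>
         (\<forall>x\<in>reachable_on A B C D (mat_ker X).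
            closed_loop A B R S X *v x = closed_loop A B R S Y *v x)"
proof -
  have sol: "riccati_solution A B C D X" "riccati_solution A B C D Y"
    using assms by (simp_all add: riccati_solution_def)
  then have "two_riccati_solutions A B C D X Y" "two_riccati_solutions A B C D Y X"
    by (simp_all add: two_riccati_solutions_def)
  then have "reachable_on A B C D (mat_ker X) = reachable_on A B C D (mat_ker Y)"
    by (intro equalityI two_riccati_solutions.reachable_subset)
  then show ?thesis
    using gain_eq_on_reachable[OF sol]
    by (simp add: assms(2,3) riccati_solution.closed_loop_eq[OF sol(1)]
        riccati_solution.closed_loop_eq[OF sol(2)] matrix_vector_mult_diff_rdistrib
        flip: matrix_vector_mul_assoc)
qed

end
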